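(* Let $(D,\dashv,\vdash,\alpha_D)$ be a Hom-dialgebra. Define the bilinear map $[-,-]:D\otimes D\to D$ by $$[x,y]:=x\vdash y-y\dashv x.$$ Then $(D,\dashv,[-,-],\alpha_D)$ is a (non-commutative) Hom-Leibniz-Poisson algebra, with $\dashv$ as its Hom-associative product.
   Context: $\mathbf K$ is a field of characteristic $0$. A Hom-dialgebra is a quadruple $(D,\dashv,\vdash,\alpha_D)$ where $D$ is a $\mathbf K$-vector space, $\dashv,\vdash:D\otimes D\to D$ are bilinear maps and $\alpha_D:D\to D$ is a linear map such that for all $x,y,z\in D$ $$(x\vdash y)\dashv\alpha_D(z)=\alpha_D(x)\vdash(y\dashv z),$$ $$\alpha_D(x)\dashv(y\dashv z)=(x\dashv y)\dashv\alpha_D(z)=\alpha_D(x)\dashv(y\vdash z),$$ $$(x\dashv y)\vdash\alpha_D(z)=\alpha_D(x)\vdash(y\vdash z)=(x\vdash y)\vdash\alpha_D(z).$$ A (non-commutative) Hom-Leibniz-Poisson algebra $(P,\mu,[-,-],\alpha_P)$ is a vector space $P$ with bilinear maps $\mu,[-,-]:P\otimes P\to P$ and a linear map $\alpha_P:P\to P$ such that for all $x,y,z\in P$: (i) $[\alpha_P(x),[y,z]]=[[x,y],\alpha_P(z)]+[\alpha_P(y),[x,z]]$; (ii) $\mu(\alpha_P(x),\mu(y,z))=\mu(\mu(x,y),\alpha_P(z))$; (iii) $[\alpha_P(x),\mu(y,z)]=\mu([x,y],\alpha_P(z))+\mu(\alpha_P(y),[x,z])$. (No commutativity of $\mu$ is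 required.) *)

theory Defs
  imports Complex_Main
begin

definition bilinear_over ::
  "('k::field \<Rightarrow> 'v::ab_group_add \<Rightarrow> 'v) \<Rightarrow> ('v \<Rightarrow> 'v \<Rightarrow> 'v) \<Rightarrow> bool" where
  "bilinear_over scale m \<longleftrightarrow>
     (\<forall>x. Vector_Spaces.linear scale scale (\<lambda>y. m x y)) \<and>
     (\<forall>y. Vector_Spaces.linear scale scale (\<lambda>x. m x y))"

locale hom_dialgebra = vector_space scale
  for scale :: "'k::field_char_0 \<Rightarrow> 'v::ab_group_add \<Rightarrow> 'v" +
  fixes lprod :: "'v \<Rightarrow> 'v \<Rightarrow> 'v" (infixl \<open>\<stileturn>\<close> 70)
    and rprod :: "'v \<Rightarrow> 'v \<Rightarrow> 'v" (infixl \<open>\<turnstile>\<close> 70)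
    and \<alpha> :: "'v \<Rightarrow> 'v"
  assumes bilinear_lprod: "bilinear_over scale (\<stileturn>)"
    and bilinear_rprod: "bilinear_over scale (\<turnstile>)"
    and linear_twist: "Vector_Spaces.linear scale scale \<alpha>"
    and inner_assoc: "(x \<turnstile> y) \<stileturn> \<alpha> z = \<alpha> x \<turnstile> (y \<stileturn> z)"
    and left_assoc: "\<alpha> x \<stileturn> (y \<stileturn> z) = (x \<stileturn> y) \<stileturn> \<alpha> z"
    and left_bar: "(x \<stileturn> y) \<stileturn> \<alpha> z = \<alpha> x \<stileturn> (y \<turnstile> z)"
    and right_bar: "(x \<stileturn> y) \<turnstile> \<alpha> z = \<alpha> x \<turnstile> (y \<turnstile> z)"
    and right_assoc: "\<alpha> x \<turnstile> (y \<turnstile> z) = (x \<turnstile> y) \<turnstile> \<alpha> z"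

locale hom_leibniz_poisson = vector_space scale
  for scale :: "'k::field_char_0 \<Rightarrow> 'v::ab_group_add \<Rightarrow> 'v" +
  fixes \<mu> :: "'v \<Rightarrow> 'v \<Rightarrow> 'v"
    and bracket :: "'v \<Rightarrow> 'v \<Rightarrow> 'v"
    and \<alpha> :: "'v \<Rightarrow> 'v"
  assumes bilinear_mult: "bilinear_over scale \<mu>"
    and bilinear_bracket: "bilinear_over scale bracket"
    and linear_twist: "Vector_Spaces.linear scale scale \<alpha>"
    and hom_leibniz:
      "bracket (\<alpha> x) (bracket y z) = bracket (bracket x y) (\<alpha> z) + bracket (\<alpha> y) (bracket x z)"
    and hom_assoc: "\<mu> (\<alpha> x) (\<mu> y z) = \<mu> (\<mu> x y) (\<alpha> z)"
    and hom_poisson: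
      "bracket (\<alpha> x) (\<mu> y z) = \<mu> (bracket x y) (\<alpha> z) + \<mu> (\<alpha> y) (bracket x z)"

definition dialgebra_bracket ::
  "('v::ab_group_add \<Rightarrow> 'v \<Rightarrow> 'v) \<Rightarrow> ('v \<Rightarrow> 'v \<Rightarrow> 'v) \<Rightarrow> 'v \<Rightarrow> 'v \<Rightarrow> 'v" where
  "dialgebra_bracket lprod rprod x y = rprod x y - lprod y x"

end

theory Submission
  imports Defs
begin

text \<open>The axioms bring every triple product, for a fixed order of its letters, to one of three
  words, each determined by the letter that both products point to: the first in
  \<open>(x \<stileturn> y) \<stileturn> \<alpha> z\<close>, the second in
  \<open>\<alpha> x \<turnstile> (y \<stileturn> z)\<close>, the third in
  \<open>\<alpha> x \<turnstile> (y \<turnstile> z)\<close>. Expanding the brackets by bilinearity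
  turns the Leibniz and Poisson identities into signed sums of such words, which agree after
  cancellation.\<close>

lemma bilinear_overD:
  assumes "bilinear_over scale m"
  shows "m x (y + z) = m x y + m x z" "m (x + y) z = m x z + m y z"
    and "m x (y - z) = m x y - m x z" "m (x - y) z = m x z - m y z"
    and "m x (scale c y) = scale c (m x y)" "m (scale c x) y = scale c (m x y)"
proof -
  interpret r: Vector_Spaces.linear scale scale "\<lambda>y. m x y" for x
    using assms by (simp add: bilinear_over_def)
  interpret l: Vector_Spaces.linear scale scale "\<lambda>x. m x y" for y
    using assms by (simp add: bilinear_over_def)
  show "m x (y + z) = m x y + m x z" "m (x + y) z = m x z + m y z"
    and "m x (y - z) = m x y - m x z" "m (x - y) z = m x z - m y z"
    and "m x (scale c y) = scale c (m x y)" "m (scale c x) y = scale c (m x y)"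
    by (fact r.add l.add r.diff l.diff r.scale l.scale)+
qed

context hom_dialgebra
begin

lemma bilinear_dialgebra_bracket: "bilinear_over scale (dialgebra_bracket (\<stileturn>) (\<turnstile>))"
  unfolding bilinear_over_def dialgebra_bracket_def Vector_Spaces.linear_iff
  by (simp add: vector_space_axioms bilinear_overD[OF bilinear_lprod]
      bilinear_overD[OF bilinear_rprod] scale_right_diff_distrib)

lemma dialgebra_bracket_hom_leibniz_poisson:
  "hom_leibniz_poisson scale (\<stileturn>) (dialgebra_bracket (\<stileturn>) (\<turnstile>)) \<alpha>"
proof (intro hom_leibniz_poisson.intro hom_leibniz_poisson_axioms.intro)
  note bilin = bilinear_overD[OF bilinear_lprod] bilinear_overD[OF bilinear_rprod]
  \<comment> \<open>Oriented so that all five equations rewrite towards the three normal words; the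
    reversed ones would otherwise lead away from them.\<close>
  note assoc = inner_assoc left_assoc left_bar[symmetric] right_bar right_assoc[symmetric]
  let ?b = "dialgebra_bracket (\<stileturn>) (\<turnstile>)"
  show "vector_space scale"
    by (fact vector_space_axioms)
  show "bilinear_over scale (\<stileturn>)" "bilinear_over scale ?b"
    and "Vector_Spaces.linear scale scale \<alpha>"
    by (fact bilinear_lprod bilinear_dialgebra_bracket linear_twist)+
  \<comment> \<open>On the right, \<open>\<alpha> y \<turnstile> (x \<turnstile> z)\<close> and
    \<open>(z \<stileturn> x) \<stileturn> \<alpha> y\<close> each occur with both signs; the four
    words left all point to \<open>z\<close> and make up the left side.\<close>
  show "?b (\<alpha> x) (?b y z) = ?b (?b x y) (\<alpha> z) + ?b (\<alpha> y) (?b x z)" for x y z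
    by (simp add: dialgebra_bracket_def bilin assoc)
  show "\<alpha> x \<stileturn> (y \<stileturn> z) = (x \<stileturn> y) \<stileturn> \<alpha> z" for x y z
    by (fact left_assoc)
  \<comment> \<open>All words point to \<open>y\<close>. The two copies of
    \<open>(y \<stileturn> x) \<stileturn> \<alpha> z\<close> on the right cancel, one of them
    arising from \<open>\<alpha> y \<stileturn> (x \<turnstile> z)\<close> by
    \<open>left_bar\<close>.\<close>
  show "?b (\<alpha> x) (y \<stileturn> z) = ?b x y \<stileturn> \<alpha> z + \<alpha> y \<stileturn> ?b x z" for x y z
    by (simp add: dialgebra_bracket_def bilin assoc)
qed

end

theorem theorem4p3:
  fixes scale :: "'k::field_char_0 \<Rightarrow> 'v::ab_group_add \<Rightarrow> 'v"
    and lprod rprod :: "'v \<Rightarrow> 'v \<Rightarrow> 'v"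
    and \<alpha> :: "'v \<Rightarrow> 'v"
  assumes "hom_dialgebra scale lprod rprod \<alpha>"
  shows "hom_leibniz_poisson scale lprod (dialgebra_bracket lprod rprod) \<alpha>"
  using assms by (rule hom_dialgebra.dialgebra_bracket_hom_leibniz_poisson)

end
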